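(* Let $n>k>i$ be non-negative integers such that the generalized Johnson graph $G=J(n,k,i)$ is connected. Then $\mathrm{rc}(G)=\mathrm{rad}(G)-1$.
   Context: The generalized Johnson graph $J(n,k,i)$ has as vertices the $k$-element subsets of an $n$-element set, vertices $A,B$ being adjacent iff $|A\cap B|=i$. Cop and robber game with radius of capture $r$: first the cop chooses a vertex, then the robber; afterwards, starting with the cop, the players alternately either move to an adjacent vertex or stay put, both knowing both positions. The cop wins if at some point the distance between the players is at most $r$. $\mathcal{CWRC}(r)$ is the class of graphs on which the cop has a winning strategy. $\mathrm{rc}(G)=\min\{r\in\mathbb{N}_0 \mid G\in\mathcal{CWRC}(r)\}$. $\mathrm{rad}$ denotes the radius. *)

theory Defs
  imports "Graph_Theory.Graph_Theory"
begin

(* Simple graphs are symmetric loop-free pair digraphs; an undirected edge is a pair of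
   opposite arcs. For i < k no vertex is related to itself below. *)
definition gen_johnson :: "nat \<Rightarrow> nat \<Rightarrow> nat \<Rightarrow> nat set pair_pre_digraph" where
  "gen_johnson n k i =
    \<lparr> pverts = {A. A \<subseteq> {1..n} \<and> card A = k},
      parcs = {(A, B). A \<subseteq> {1..n} \<and> card A = k \<and> B \<subseteq> {1..n} \<and> card B = k
                 \<and> card (A \<inter> B) = i} \<rparr>"

lemma pair_graph_gen_johnson:
  assumes "i < k"
  shows "pair_graph (gen_johnson n k i)"
proof -
  have mem: "(A, B) \<in> parcs (gen_johnson n k i) \<longleftrightarrow>
      A \<in> pverts (gen_johnson n k i) \<and> B \<in> pverts (gen_johnson n k i) \<and> card (A \<inter> B) = i" for A B
    by (simp add: gen_johnson_def)
  have card: "card A = k" if "A \<in> pverts (gen_johnson n k i)" for A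
    using that by (simp add: gen_johnson_def)
  have fin: "finite (pverts (gen_johnson n k i))"
    by (rule finite_subset[of _ "Pow {1..n}"]) (auto simp: gen_johnson_def)
  have finE: "finite (parcs (gen_johnson n k i))"
    by (rule finite_subset[OF _ finite_cartesian_product[OF fin fin]]) (clarsimp simp: mem)
  show ?thesis
  proof
    fix e assume e: "e \<in> parcs (gen_johnson n k i)"
    obtain A B where AB: "e = (A, B)" by (cases e)
    show "fst e \<in> pverts (gen_johnson n k i)" "snd e \<in> pverts (gen_johnson n k i)"
      using e by (simp_all add: AB mem)
    show "fst e \<noteq> snd e"
    proof
      assume "fst e = snd e"
      with e have "A \<in> pverts (gen_johnson n k i)" "card A = i" by (simp_all add: AB mem)
      with card assms show False by fastforce
    qed
  next
    show "symmetric (with_proj (gen_johnson n k i))"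
      unfolding symmetric_def with_proj_simps
      by (rule symI) (simp add: mem Int_commute)
  qed (fact fin finE)+
qed

(* Shortest-path distance with unit arc costs; it is infinite if there is no walk. *)
definition gdist :: "'a pair_pre_digraph \<Rightarrow> 'a \<Rightarrow> 'a \<Rightarrow> ereal" where
  "gdist G u v = wf_digraph.\<mu> (with_proj G) (\<lambda>_. 1) u v"

definition eccentricity :: "'a pair_pre_digraph \<Rightarrow> 'a \<Rightarrow> ereal" where
  "eccentricity G u = (SUP v \<in> pverts G. gdist G u v)"

definition radius :: "'a pair_pre_digraph \<Rightarrow> ereal" where
  "radius G = (INF u \<in> pverts G. eccentricity G u)"

(* Where a player at u may be after one turn: an adjacent vertex, or u itself. *)
definition moves :: "'a pair_pre_digraph \<Rightarrow> 'a \<Rightarrow> 'a set" where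
  "moves G u = insert u {v. (u, v) \<in> parcs G}"

(* A cop strategy maps the history, i.e. the list of (cop, robber) positions before each of the
   cop's turns so far (oldest first), to the cop's next position. *)
definition cop_strategy :: "'a pair_pre_digraph \<Rightarrow> (('a \<times> 'a) list \<Rightarrow> 'a) \<Rightarrow> bool" where
  "cop_strategy G \<sigma> \<longleftrightarrow> (\<forall>h. \<forall>c \<in> pverts G. \<forall>r \<in> pverts G. \<sigma> (h @ [(c, r)]) \<in> moves G c)"

(* The players are at c t and r t before the cop's turn number t; the cop then moves to c (Suc t)
   as told by her strategy, and after that the robber moves to r (Suc t) as he likes.
   Plays are continued forever; the game is decided by whether a capture ever occurs. *)
definition play ::
  "'a pair_pre_digraph \<Rightarrow> 'a \<Rightarrow> (('a \<times> 'a) list \<Rightarrow> 'a) \<Rightarrow> (nat \<Rightarrow> 'a) \<Rightarrow> (nat \<Rightarrow> 'a) \<Rightarrow> bool" where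
  "play G c\<^sub>0 \<sigma> c r \<longleftrightarrow>
     c 0 = c\<^sub>0 \<and> r 0 \<in> pverts G
     \<and> (\<forall>t. c (Suc t) = \<sigma> (map (\<lambda>s. (c s, r s)) [0..<Suc t]))
     \<and> (\<forall>t. r (Suc t) \<in> moves G (r t))"

(* The two disjuncts are the positions before and after the cop's turn number t. *)
definition captured ::
  "'a pair_pre_digraph \<Rightarrow> nat \<Rightarrow> (nat \<Rightarrow> 'a) \<Rightarrow> (nat \<Rightarrow> 'a) \<Rightarrow> bool" where
  "captured G \<rho> c r \<longleftrightarrow>
     (\<exists>t. gdist G (c t) (r t) \<le> ereal (real \<rho>) \<or> gdist G (c (Suc t)) (r t) \<le> ereal (real \<rho>))"

definition CWRC :: "nat \<Rightarrow> 'a pair_pre_digraph set" where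
  "CWRC \<rho> = {G. pair_bidirected_digraph G \<and>
     (\<exists>c\<^sub>0 \<in> pverts G. \<exists>\<sigma>. cop_strategy G \<sigma> \<and> (\<forall>c r. play G c\<^sub>0 \<sigma> c r \<longrightarrow> captured G \<rho> c r))}"

definition rc :: "'a pair_pre_digraph \<Rightarrow> nat" where
  "rc G = (LEAST \<rho>. G \<in> CWRC \<rho>)"

end

(* In a connected graph with an edge the cop wins with capture radius rad - 1: she starts at
   a centre and steps once towards the robber.  Conversely, any two vertices of a generalized
   Johnson graph are interchanged by an automorphism.  When the cop moves from c to c', the robber at r applies an
   automorphism f swapping c' and r and moves to f c: this is a legal move, since c' is adjacent or
   equal to c, and d(c', f c) = d(f r, f c) = d(c, r), as distances are symmetric.  So the robber
   preserves the initial distance forever, and the cop's own moves shorten it by at most one. *)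
theory Submission
  imports Defs
begin

section \<open>Distances\<close>

context pair_wf_digraph
begin

lemma gdist_eq_INF_length: "gdist G u v = (INF p\<in>{p. awalk u p v}. ereal (real (length p)))"
  unfolding gdist_def \<mu>_def awalk_cost_def by (simp add: sum_list_triv)

text \<open>Lengths are natural numbers, so if every walk is longer than \<open>n\<close>, then
  \<open>n + 1\<close> is a lower bound for the infimum. This also covers the case of no walk at
  all, where the infimum is infinite. It lets later proofs argue with walks instead of extended
  reals.\<close>

lemma gdist_le_iff: "gdist G u v \<le> ereal (real n) \<longleftrightarrow> (\<exists>p. awalk u p v \<and> length p \<le> n)"
proof
  assume le: "gdist G u v \<le> ereal (real n)"
  show "\<exists>p. awalk u p v \<and> length p \<le> n"
  proof (rule ccontr)
    assume "\<nexists>p. awalk u p v \<and> length p \<le> n"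
    then have "ereal (real (Suc n)) \<le> gdist G u v"
      unfolding gdist_eq_INF_length by (intro INF_greatest) (auto simp: not_le)
    with le have "ereal (real (Suc n)) \<le> ereal (real n)" by (rule order_trans[rotated])
    then show False by simp
  qed
next
  assume "\<exists>p. awalk u p v \<and> length p \<le> n"
  then show "gdist G u v \<le> ereal (real n)"
    unfolding gdist_eq_INF_length by (auto intro: INF_lower2)
qed

lemma gdist_nat:
  assumes "u \<rightarrow>\<^sup>*\<^bsub>with_proj G\<^esub> v"
  shows "gdist G u v \<in> range (\<lambda>n::nat. ereal (real n))"
proof -
  have "\<exists>n p. awalk u p v \<and> length p \<le> n" using assms by (auto simp: reachable_awalk)
  then have ex: "\<exists>n. gdist G u v \<le> ereal (real n)" by (simp add: gdist_le_iff)
  \<comment> \<open>Every walk length is a natural upper bound of the distance, so the least such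
    bound lies below all walk lengths and hence below the infimum.\<close>
  define m where "m = (LEAST n. gdist G u v \<le> ereal (real n))"
  have le: "gdist G u v \<le> ereal (real m)" unfolding m_def using ex by (rule LeastI_ex)
  have "ereal (real m) \<le> gdist G u v"
    unfolding gdist_eq_INF_length
  proof (intro INF_greatest)
    fix p assume "p \<in> {p. awalk u p v}"
    then have "gdist G u v \<le> ereal (real (length p))" by (auto simp: gdist_le_iff)
    then show "ereal (real m) \<le> ereal (real (length p))" by (simp add: m_def Least_le)
  qed
  with le show ?thesis by (auto intro: antisym)
qed

lemma gdist_le_Suc_if_move:
  assumes "w \<in> moves G u" "gdist G w v \<le> ereal (real n)"
  shows "gdist G u v \<le> ereal (real (Suc n))"
proof -
  obtain p where p: "awalk w p v" "length p \<le> n" using assms(2) by (auto simp: gdist_le_iff)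
  show ?thesis
  proof (cases "w = u")
    case True
    with p show ?thesis unfolding gdist_le_iff by (auto intro: le_SucI)
  next
    case False
    with assms(1) have "(u, w) \<in> parcs G" by (simp add: moves_def)
    with p(1) have "awalk u ((u, w) # p) v"
      by (auto simp: awalk_Cons_iff intro: in_arcsD1)
    with p(2) show ?thesis unfolding gdist_le_iff by force
  qed
qed

text \<open>The move is the first arc of a short walk. If that walk is empty, the distance is
  already 0 and staying put suffices.\<close>

lemma ex_move_closer:
  assumes "gdist G u v \<le> ereal (real (Suc n))"
  shows "\<exists>w\<in>moves G u. gdist G w v \<le> ereal (real n)"
proof -
  obtain p where p: "awalk u p v" "length p \<le> Suc n"
    using assms unfolding gdist_le_iff by blast
  show ?thesis
  proof (cases p)
    case Nil
    with p have "gdist G u v \<le> ereal (real n)" unfolding gdist_le_iff by force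
    then show ?thesis by (auto simp: moves_def)
  next
    case (Cons e q)
    with p(1) have "(u, snd e) \<in> parcs G" "awalk (snd e) q v" by (auto simp: awalk_Cons_iff)
    with p(2) Cons show ?thesis
      by (intro bexI[of _ "snd e"]) (auto simp: moves_def gdist_le_iff)
  qed
qed

lemma moves_in_verts: "w \<in> moves G u \<Longrightarrow> u \<in> pverts G \<Longrightarrow> w \<in> pverts G"
  by (auto simp: moves_def intro: in_arcsD2)

end

lemma (in pair_sym_digraph) gdist_commute: "gdist G u v = gdist G v u"
proof -
  have "gdist G u v \<le> gdist G v u" for u v
    unfolding gdist_eq_INF_length
  proof (intro INF_greatest)
    fix p assume "p \<in> {p. awalk v p u}"
    then have "awalk u (rev_path p) v" by simp
    moreover have "length (rev_path p) = length p" by (induction p) auto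
    ultimately show "(INF q\<in>{q. awalk u q v}. ereal (real (length q))) \<le> ereal (real (length p))"
      by (auto intro!: INF_lower2[of "rev_path p"])
  qed
  then show ?thesis by (intro antisym)
qed

section \<open>Automorphisms\<close>

definition automorphism :: "'a pair_pre_digraph \<Rightarrow> ('a \<Rightarrow> 'a) \<Rightarrow> bool" where
  "automorphism G f \<longleftrightarrow> bij_betw f (pverts G) (pverts G) \<and>
     (\<forall>x\<in>pverts G. \<forall>y\<in>pverts G. (f x, f y) \<in> parcs G \<longleftrightarrow> (x, y) \<in> parcs G)"

text \<open>The automorphism group is generously transitive. This is stronger than
  vertex-transitivity, as a single automorphism has to exchange both vertices.\<close>

definition interchangeable :: "'a pair_pre_digraph \<Rightarrow> bool" where
  "interchangeable G \<longleftrightarrow>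
     (\<forall>u\<in>pverts G. \<forall>v\<in>pverts G. \<exists>f. automorphism G f \<and> f u = v \<and> f v = u)"

context pair_wf_digraph
begin

text \<open>The image of a walk is a walk of the same length. If \<open>u\<close> or
  \<open>v\<close> is not a vertex, there is no walk and the right-hand side is infinite.\<close>

lemma gdist_homomorphism_le:
  assumes verts: "\<And>x. x \<in> pverts G \<Longrightarrow> f x \<in> pverts G"
    and arcs: "\<And>x y. (x, y) \<in> parcs G \<Longrightarrow> (f x, f y) \<in> parcs G"
  shows "gdist G (f u) (f v) \<le> gdist G u v"
proof -
  have map: "awalk (f u) (map (map_prod f f) p) (f v)" if "awalk u p v" for p u
    using that by (induction p arbitrary: u) (auto simp: awalk_simps intro: verts arcs)
  show ?thesis
    unfolding gdist_eq_INF_length[of u]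
  proof (intro INF_greatest)
    fix p assume "p \<in> {p. awalk u p v}"
    then show "gdist G (f u) (f v) \<le> ereal (real (length p))"
      unfolding gdist_le_iff using map by (auto intro!: exI[of _ "map (map_prod f f) p"])
  qed
qed

lemma gdist_automorphism:
  assumes f: "automorphism G f" and uv: "u \<in> pverts G" "v \<in> pverts G"
  shows "gdist G (f u) (f v) = gdist G u v"
proof (rule antisym)
  have bij: "bij_betw f (pverts G) (pverts G)" using f by (simp add: automorphism_def)
  have verts: "f x \<in> pverts G" if "x \<in> pverts G" for x
    using bij that by (rule bij_betwE[rule_format])
  have iff: "(f x, f y) \<in> parcs G \<longleftrightarrow> (x, y) \<in> parcs G" if "x \<in> pverts G" "y \<in> pverts G" for x y
    using f that by (simp add: automorphism_def)
  show "gdist G (f u) (f v) \<le> gdist G u v"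
  proof (rule gdist_homomorphism_le)
    fix x y assume "(x, y) \<in> parcs G"
    then show "(f x, f y) \<in> parcs G" using iff[of x y] in_arcsD1[of x y] in_arcsD2[of x y] by simp
  qed (rule verts)
  \<comment> \<open>The reverse inequality comes from the inverse on the vertex set, which maps arcs
    to arcs because \<open>f\<close> also reflects them.\<close>
  define g where "g = inv_into (pverts G) f"
  have gverts: "g x \<in> pverts G" if "x \<in> pverts G" for x
    unfolding g_def using bij_betwE[OF bij_betw_inv_into[OF bij]] that by blast
  have fg: "f (g x) = x" if "x \<in> pverts G" for x
    unfolding g_def using bij that by (rule bij_betw_inv_into_right)
  have gf: "g (f x) = x" if "x \<in> pverts G" for x
    unfolding g_def using bij that by (rule bij_betw_inv_into_left)
  have "gdist G (g (f u)) (g (f v)) \<le> gdist G (f u) (f v)"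
  proof (rule gdist_homomorphism_le)
    fix x y assume xy: "(x, y) \<in> parcs G"
    then have "x \<in> pverts G" "y \<in> pverts G" by (auto dest: in_arcsD1 in_arcsD2)
    with xy show "(g x, g y) \<in> parcs G" using iff[of "g x" "g y"] by (simp add: fg gverts)
  qed (rule gverts)
  then show "gdist G u v \<le> gdist G (f u) (f v)" by (simp add: gf uv)
qed

end

section \<open>Radius and capture\<close>

lemma (in pair_fin_digraph) radius_attained:
  assumes "pverts G \<noteq> {}"
  obtains u where "u \<in> pverts G" "eccentricity G u = radius G"
proof -
  have "radius G = Min (eccentricity G ` pverts G)"
    unfolding radius_def using assms pair_finite_verts by (simp add: Min_Inf)
  also have "\<dots> \<in> eccentricity G ` pverts G"
    using assms pair_finite_verts by (intro Min_in) auto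
  finally show thesis using that by auto
qed

lemma (in pair_fin_digraph) eccentricity_attained:
  assumes "pverts G \<noteq> {}"
  obtains v where "v \<in> pverts G" "gdist G u v = eccentricity G u"
proof -
  have "eccentricity G u = Max (gdist G u ` pverts G)"
    unfolding eccentricity_def using assms pair_finite_verts by (simp add: Max_Sup)
  also have "\<dots> \<in> gdist G u ` pverts G"
    using assms pair_finite_verts by (intro Max_in) auto
  finally show thesis using that by auto
qed

text \<open>The radius is the distance from a centre to a farthest vertex, finite by connectedness.
  Were it 0, every vertex would coincide with the centre.\<close>

lemma (in pair_pseudo_graph) radius_positive_nat:
  assumes "connected (with_proj G)" and xy: "x \<in> pverts G" "y \<in> pverts G" "x \<noteq> y"
  obtains m :: nat where "radius G = ereal (real (Suc m))"
proof -
  have ne: "pverts G \<noteq> {}" using xy by blast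
  obtain u where u: "u \<in> pverts G" "eccentricity G u = radius G"
    using ne by (rule radius_attained)
  obtain v where v: "v \<in> pverts G" "gdist G u v = eccentricity G u"
    using ne by (rule eccentricity_attained)
  have "strongly_connected (with_proj G)"
    using assms(1) by (intro symmetric_connected_imp_strongly_connected pair_sym_arcs)
  then have "u \<rightarrow>\<^sup>*\<^bsub>with_proj G\<^esub> v" using u v by (simp add: strongly_connected_def)
  then obtain N :: nat where N: "radius G = ereal (real N)"
    using gdist_nat[of u v] u v by auto
  moreover have "N \<noteq> 0"
  proof
    assume "N = 0"
    have "z = u" if "z \<in> pverts G" for z
    proof -
      have "gdist G u z \<le> eccentricity G u"
        unfolding eccentricity_def using that by (rule SUP_upper)
      then have "gdist G u z \<le> ereal (real 0)" using u N \<open>N = 0\<close> by simp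
      then show ?thesis unfolding gdist_le_iff by (auto simp: awalk_Nil_iff)
    qed
    with xy show False by blast
  qed
  ultimately show thesis using that by (metis not0_implies_Suc)
qed

section \<open>The winning strategy of the cop\<close>

lemma (in pair_graph) CWRC_if_radius_le:
  assumes ne: "pverts G \<noteq> {}" and rad: "radius G \<le> ereal (real (Suc m))"
  shows "G \<in> CWRC m"
proof -
  obtain u where u: "u \<in> pverts G" "eccentricity G u = radius G"
    using ne by (rule radius_attained)
  define P where "P c r w \<longleftrightarrow> w \<in> moves G c \<and> gdist G w r \<le> ereal (real m)" for c r w
  \<comment> \<open>The strategy looks only at the current positions. The default \<open>c\<close>
    keeps it legal where no winning move exists, since \<open>cop_strategy\<close> quantifies over
    all histories.\<close>
  define \<sigma> where "\<sigma> h = (case last h of (c, r) \<Rightarrow> if \<exists>w. P c r w then SOME w. P c r w else c)" for h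
  have P\<sigma>: "P c r (\<sigma> (h @ [(c, r)]))" if "\<exists>w. P c r w" for c r h
    using someI_ex[OF that] that by (simp add: \<sigma>_def)
  have "\<sigma> (h @ [(c, r)]) \<in> moves G c" for h c r
  proof (cases "\<exists>w. P c r w")
    case True
    then show ?thesis using P\<sigma>[OF True, of h] by (simp add: P_def)
  next
    case False
    have "\<sigma> (h @ [(c, r)]) = c"
      by (simp only: \<sigma>_def last_snoc prod.case if_not_P[OF False])
    then show ?thesis by (simp add: moves_def)
  qed
  then have "cop_strategy G \<sigma>" by (simp add: cop_strategy_def)
  moreover have "captured G m c r" if play: "play G u \<sigma> c r" for c r
  proof -
    have c0: "c 0 = u" and r0: "r 0 \<in> pverts G" and c1: "c (Suc 0) = \<sigma> ([] @ [(c 0, r 0)])"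
      using play unfolding play_def by (auto dest: spec[of _ 0])
    have "gdist G u (r 0) \<le> eccentricity G u"
      unfolding eccentricity_def using r0 by (rule SUP_upper)
    then have "gdist G u (r 0) \<le> ereal (real (Suc m))" using u rad by simp
    then have "\<exists>w. P u (r 0) w" unfolding P_def using ex_move_closer by blast
    then have "P u (r 0) (c (Suc 0))" unfolding c1 c0 by (rule P\<sigma>)
    \<comment> \<open>The capture happens right after the cop's first turn: the second disjunct at
      time 0.\<close>
    then show ?thesis by (auto simp: P_def captured_def intro!: exI[of _ 0])
  qed
  moreover have "pair_bidirected_digraph G" by unfold_locales
  ultimately show ?thesis unfolding CWRC_def using u by blast
qed

section \<open>The evading strategy of the robber\<close>

lemma (in pair_sym_digraph) mirror_move:
  assumes inter: "interchangeable G" and c: "c \<in> pverts G" and r: "r \<in> pverts G"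
    and c': "c' \<in> moves G c"
  shows "\<exists>r'\<in>moves G r. gdist G c' r' = gdist G c r"
proof -
  have c'_verts: "c' \<in> pverts G" using c' c by (rule moves_in_verts)
  obtain f where f: "automorphism G f" "f c' = r" "f r = c'"
    using inter c'_verts r unfolding interchangeable_def by blast
  \<comment> \<open>If the cop stays put, then \<open>f c = r\<close> and so does the robber.
    Otherwise \<open>f\<close> carries the arc from \<open>c'\<close> back to \<open>c\<close> to an
    arc from \<open>r\<close> to \<open>f c\<close>.\<close>
  have "f c \<in> moves G r"
  proof (cases "c' = c")
    case True
    with f show ?thesis by (simp add: moves_def)
  next
    case False
    with c' have "(c', c) \<in> parcs G" by (auto simp: moves_def intro: arcs_symmetric)
    with f c c'_verts show ?thesis unfolding automorphism_def moves_def by auto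
  qed
  moreover have "gdist G c' (f c) = gdist G c r"
    using gdist_automorphism[OF f(1) r c] f(3) by (simp add: gdist_commute[of r])
  ultimately show ?thesis by blast
qed

lemma (in pair_sym_digraph) not_CWRC_if_less_radius:
  assumes inter: "interchangeable G" and rad: "ereal (real (Suc \<rho>)) < radius G"
  shows "G \<notin> CWRC \<rho>"
proof
  assume "G \<in> CWRC \<rho>"
  then obtain c0 \<sigma> where c0: "c0 \<in> pverts G" and strat: "cop_strategy G \<sigma>"
    and win: "\<And>c r. play G c0 \<sigma> c r \<Longrightarrow> captured G \<rho> c r"
    unfolding CWRC_def by blast
  have "radius G \<le> eccentricity G c0" unfolding radius_def using c0 by (rule INF_lower)
  with rad have "ereal (real (Suc \<rho>)) < (SUP v\<in>pverts G. gdist G c0 v)"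
    unfolding eccentricity_def by (rule less_le_trans)
  then obtain r0 where r0: "r0 \<in> pverts G" and far: "ereal (real (Suc \<rho>)) < gdist G c0 r0"
    unfolding less_SUP_iff by blast
  define reply where
    "reply c r c' = (SOME r'. r' \<in> moves G r \<and> gdist G c' r' = gdist G c r)" for c r c'
  have reply: "reply c r c' \<in> moves G r" "gdist G c' (reply c r c') = gdist G c r"
    if "c \<in> pverts G" "r \<in> pverts G" "c' \<in> moves G c" for c r c'
    using someI_ex[OF mirror_move[OF inter that, unfolded Bex_def]] by (simp_all add: reply_def)
  \<comment> \<open>The cop may use the whole past, so the recursion builds histories rather than
    positions. \<open>H t\<close> has \<open>t + 1\<close> entries and ends with the positions
    before the cop's turn \<open>t\<close>.\<close>
  define H where "H = rec_nat [(c0, r0)]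
    (\<lambda>_ h. h @ [(\<sigma> h, reply (fst (last h)) (snd (last h)) (\<sigma> h))])"
  define c where "c t = fst (last (H t))" for t
  define r where "r t = snd (last (H t))" for t
  have H_Suc: "H (Suc t) = H t @ [(\<sigma> (H t), reply (c t) (r t) (\<sigma> (H t)))]" for t
    by (simp add: H_def c_def r_def)
  have c_Suc: "c (Suc t) = \<sigma> (H t)" and r_Suc: "r (Suc t) = reply (c t) (r t) (\<sigma> (H t))" for t
    by (simp_all add: H_Suc c_def[of "Suc t"] r_def[of "Suc t"])
  have start: "c 0 = c0" "r 0 = r0" by (simp_all add: c_def r_def H_def)
  have hist: "map (\<lambda>s. (c s, r s)) [0..<Suc t] = H t" for t
  proof (induction t)
    case 0
    show ?case using start by (simp add: H_def)
  next
    case (Suc t)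
    then show ?case by (simp add: H_Suc c_Suc r_Suc)
  qed
  have H_snoc: "H t = map (\<lambda>s. (c s, r s)) [0..<t] @ [(c t, r t)]" for t
    using hist[of t] by simp
  have cop: "\<sigma> (H t) \<in> moves G (c t)" if "c t \<in> pverts G" "r t \<in> pverts G" for t
    unfolding H_snoc using strat that by (simp add: cop_strategy_def)
  \<comment> \<open>Membership in the vertex set is carried along because both the cop's strategy
    and the robber's reply are controlled only at vertices.\<close>
  have inv: "c t \<in> pverts G \<and> r t \<in> pverts G \<and> gdist G (c t) (r t) = gdist G c0 r0" for t
  proof (induction t)
    case 0
    show ?case using start c0 r0 by simp
  next
    case (Suc t)
    then show ?case using cop[of t] reply[of "c t" "r t" "\<sigma> (H t)"]
      by (auto simp: c_Suc r_Suc intro: moves_in_verts)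
  qed
  have "r (Suc t) \<in> moves G (r t)" for t
    unfolding r_Suc using inv[of t] by (intro reply cop) auto
  then have "play G c0 \<sigma> c r" unfolding play_def hist using start r0 c_Suc by simp
  then obtain t where "gdist G (c t) (r t) \<le> ereal (real \<rho>) \<or>
      gdist G (c (Suc t)) (r t) \<le> ereal (real \<rho>)"
    using win unfolding captured_def by blast
  \<comment> \<open>In either disjunct of capture the cop stands on a vertex reachable in one turn
    from \<open>c t\<close>, so \<open>c t\<close> itself is within \<rho> + 1 of the robber,
    contrary to the preserved distance.\<close>
  moreover have "c (Suc t) \<in> moves G (c t)" unfolding c_Suc using inv cop by blast
  moreover have "c t \<in> moves G (c t)" by (simp add: moves_def)
  ultimately have "gdist G (c t) (r t) \<le> ereal (real (Suc \<rho>))"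
    using gdist_le_Suc_if_move by blast
  with far inv[of t] show False by simp
qed

text \<open>Two distinct vertices make the radius positive; for a single vertex the right-hand side
  would be -1.\<close>

theorem (in pair_graph) rc_eq_radius_minus_1:
  assumes conn: "connected (with_proj G)" and inter: "interchangeable G"
    and xy: "x \<in> pverts G" "y \<in> pverts G" "x \<noteq> y"
  shows "ereal (real (rc G)) = radius G - 1"
proof -
  obtain m where m: "radius G = ereal (real (Suc m))"
    using conn xy by (rule radius_positive_nat)
  have "rc G = m"
    unfolding rc_def
  proof (rule Least_equality)
    show "G \<in> CWRC m" using xy m by (intro CWRC_if_radius_le) auto
  next
    fix \<rho> assume "G \<in> CWRC \<rho>"
    \<comment> \<open>If \<rho> < m, then \<rho> + 1 is less than m + 1, which is the radius, and
      the robber escapes.\<close>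
    then show "m \<le> \<rho>"
      using not_CWRC_if_less_radius[OF inter, of \<rho>] m by (force simp: not_le)
  qed
  with m show ?thesis by (simp add: one_ereal_def)
qed

section \<open>Generalized Johnson graphs\<close>

text \<open>\<open>A - B\<close> and \<open>B - A\<close> have equal size. A bijection between them
  and its inverse are glued together, with all other points fixed, including those of
  \<open>A \<inter> B\<close>.\<close>

lemma obtain_swapping_involution:
  assumes "finite A" "finite B" "card A = card B"
  obtains \<pi> where "\<And>x. \<pi> (\<pi> x) = x" "\<pi> ` A = B" "\<And>x. x \<notin> A \<union> B \<Longrightarrow> \<pi> x = x"
proof -
  have "card (A - B) = card (B - A)"
    using assms by (metis card_Diff_subset_Int finite_Int inf_commute)
  then obtain h where h: "bij_betw h (A - B) (B - A)"
    using assms finite_same_card_bij by blast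
  define g where "g = inv_into (A - B) h"
  have g: "bij_betw g (B - A) (A - B)" unfolding g_def using h by (rule bij_betw_inv_into)
  have hg: "h (g x) = x" if "x \<in> B - A" for x
    unfolding g_def using h that by (rule bij_betw_inv_into_right)
  have gh: "g (h x) = x" if "x \<in> A - B" for x
    unfolding g_def using h that by (rule bij_betw_inv_into_left)
  have hB: "h x \<in> B - A" if "x \<in> A - B" for x using bij_betwE[OF h] that by blast
  have gA: "g x \<in> A - B" if "x \<in> B - A" for x using bij_betwE[OF g] that by blast
  define \<pi> where "\<pi> x = (if x \<in> A - B then h x else if x \<in> B - A then g x else x)" for x
  have inv: "\<pi> (\<pi> x) = x" for x
  proof -
    consider "x \<in> A - B" | "x \<in> B - A" | "x \<notin> A - B" "x \<notin> B - A" by blast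
    then show ?thesis
    proof cases
      case 1
      then show ?thesis using hB[OF 1] gh[OF 1] by (simp add: \<pi>_def)
    next
      case 2
      then show ?thesis using gA[OF 2] hg[OF 2] by (simp add: \<pi>_def)
    next
      case 3
      then have "\<pi> x = x" by (simp only: \<pi>_def if_False)
      then show ?thesis by simp
    qed
  qed
  have AB: "\<pi> x \<in> B" if "x \<in> A" for x using hB[of x] that by (auto simp: \<pi>_def)
  have BA: "\<pi> x \<in> A" if "x \<in> B" for x using gA[of x] that by (auto simp: \<pi>_def)
  have "\<pi> ` A = B"
  proof (intro equalityI subsetI)
    fix x assume "x \<in> B"
    then show "x \<in> \<pi> ` A" using BA inv[of x] by (metis imageI)
  qed (auto intro: AB)
  with inv show thesis by (rule that) (auto simp: \<pi>_def)
qed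

text \<open>A permutation of the ground set preserves the sizes of sets and of intersections, so it
  acts on the graph. Taking an involution makes \<open>\<pi>\<close> A = B\<open>give\<close>\<pi>
  \<open>B = A\<close> as well.\<close>

lemma interchangeable_gen_johnson: "interchangeable (gen_johnson n k i)"
  unfolding interchangeable_def
proof (intro ballI)
  fix A B assume "A \<in> pverts (gen_johnson n k i)" "B \<in> pverts (gen_johnson n k i)"
  then have A: "A \<subseteq> {1..n}" "card A = k" and B: "B \<subseteq> {1..n}" "card B = k"
    by (auto simp: gen_johnson_def)
  have "finite A" "finite B" "card A = card B"
    using A B by (simp_all add: finite_subset[OF _ finite_atLeastAtMost])
  then obtain \<pi> where inv: "\<And>x. \<pi> (\<pi> x) = x" and AB: "\<pi> ` A = B"
    and fixed: "\<And>x. x \<notin> A \<union> B \<Longrightarrow> \<pi> x = x"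
    by (rule obtain_swapping_involution) (rule that)
  have inj: "inj_on \<pi> X" for X by (rule inj_on_inverseI[of _ \<pi>]) (rule inv)
  have img: "\<pi> ` \<pi> ` X = X" for X by (simp add: image_image inv)
  have BA: "\<pi> ` B = A" using AB img by blast
  \<comment> \<open>Only points of \<open>A \<union> B\<close> are moved, and they stay in
    \<open>A \<union> B\<close>, which lies in the ground set.\<close>
  have range: "\<pi> x \<in> {1..n}" if "x \<in> {1..n}" for x
  proof (cases "x \<in> A \<union> B")
    case True
    then have "\<pi> x \<in> A \<union> B" using AB BA by (metis Un_iff imageI)
    then show ?thesis using A(1) B(1) by (meson UnE subsetD)
  next
    case False
    then show ?thesis using fixed[of x] that by simp
  qed
  have card: "card (\<pi> ` X) = card X" for X by (rule card_image[OF inj])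
  have Int: "card (\<pi> ` X \<inter> \<pi> ` Y) = card (X \<inter> Y)" for X Y
    using card[of "X \<inter> Y"] image_Int[OF inj[of UNIV], of X Y] by metis
  have verts: "\<pi> ` X \<in> pverts (gen_johnson n k i)" if "X \<in> pverts (gen_johnson n k i)" for X
  proof -
    have "X \<subseteq> {1..n}" "card X = k" using that by (simp_all add: gen_johnson_def)
    moreover from this(1) have "\<pi> ` X \<subseteq> {1..n}" by (blast intro: range)
    ultimately show ?thesis by (simp add: gen_johnson_def card)
  qed
  \<comment> \<open>The induced map on sets is an involution too, hence its own inverse.\<close>
  have "bij_betw ((`) \<pi>) (pverts (gen_johnson n k i)) (pverts (gen_johnson n k i))"
    by (rule bij_betw_byWitness[where f' = "(`) \<pi>"]) (auto simp only: img intro!: verts)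
  moreover have "(\<pi> ` X, \<pi> ` Y) \<in> parcs (gen_johnson n k i) \<longleftrightarrow> (X, Y) \<in> parcs (gen_johnson n k i)"
    if "X \<in> pverts (gen_johnson n k i)" "Y \<in> pverts (gen_johnson n k i)" for X Y
    using that verts[of X] verts[of Y] by (simp add: gen_johnson_def Int)
  ultimately have "automorphism (gen_johnson n k i) ((`) \<pi>)"
    unfolding automorphism_def by blast
  with AB BA show "\<exists>f. automorphism (gen_johnson n k i) f \<and> f A = B \<and> f B = A" by blast
qed

theorem theorem4p6:
  fixes n k i :: nat
  assumes "n > k" and "k > i"
    and "connected (with_proj (gen_johnson n k i))"
  shows "ereal (real (rc (gen_johnson n k i))) = radius (gen_johnson n k i) - 1"
proof -
  interpret pair_graph "gen_johnson n k i" using assms(2) by (rule pair_graph_gen_johnson)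
  \<comment> \<open>Two distinct vertices: \<open>k > 0\<close> puts 1 into the first set only, and
    \<open>k < n\<close> keeps \<open>Suc k\<close> inside the ground set.\<close>
  have "1 \<in> {1..k}" "1 \<notin> {2..Suc k}" using assms(2) by auto
  then have "{1..k} \<noteq> {2..Suc k}" by blast
  moreover have "{1..k} \<in> pverts (gen_johnson n k i)" "{2..Suc k} \<in> pverts (gen_johnson n k i)"
    using assms(1) by (auto simp: gen_johnson_def)
  ultimately show ?thesis
    using rc_eq_radius_minus_1[OF assms(3) interchangeable_gen_johnson] by blast
qed

end
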